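(* Let $G$ and $H$ be finite, simple, undirected, connected graphs, where $G$ has the uni-ecc property and center $C_G$, and let $\varphi:V(G)\to V(H)$ be a surjective $(A,B,C)$-quasi-isometry. Then the center-shift of $\varphi$ satisfies \[ d_G\big(C_G,\varphi^{-1}(C_H)\big)\le \left(A-\frac1A\right)\mathrm{rad}(H)+AB+\frac BA, \] where $C_H$ is the center of $H$.
   Context: Distances are shortest-path distances; for vertex sets $S_1,S_2$, $d(S_1,S_2)=\min\{d(v_1,v_2):v_1\in S_1,v_2\in S_2\}$, and $d(v,S)=\min_{x\in S}d(v,x)$. The eccentricity of $v$ is $\mathrm{ecc}(v)=\max_x d(v,x)$; the center of a graph is the set of vertices of minimum eccentricity; $\mathrm{rad}$ is the minimum eccentricity. A graph $G$ with center $C_G$ has the uni-ecc property if $d_G(C_G,v)=\mathrm{ecc}(v)-\mathrm{rad}(G)$ for all $v\in V(G)$. For non-negative integers $A,B,C$ with $A\ge1$, $f:V(G)\to V(H)$ is an $(A,B,C)$-quasi-isometry if for all $x,y$: $\frac1A d_G(x,y)-B\le d_H(f(x),f(y))\le A\,d_G(x,y)+B$, and for every $y\in V(H)$ there is $x$ with $d_H(y,f(x))\le C$. The center-shift of a surjective map $\varphi:G\to H$ is $d_G(C_G,\varphi^{-1}(C_H))$. *)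

theory Defs
  imports "Graph_Theory.Graph_Theory"
begin

text \<open>
  A finite simple undirected graph is a symmetric digraph without loops and multiple arcs
  (locale \<^locale>\<open>graph\<close>), every undirected edge being a pair of opposite arcs.
  The shortest-path cost \<open>\<mu>\<close> with unit weights is then the usual graph distance.
  It is an extended real, finite between any two vertices of a connected graph,
  so the conversion to real loses nothing there.
\<close>

definition gdist :: "('a, 'b) pre_digraph \<Rightarrow> 'a \<Rightarrow> 'a \<Rightarrow> real" where
  "gdist G u v = real_of_ereal (wf_digraph.\<mu> G (\<lambda>_. 1) u v)"

text \<open>
  The distance between a set and a single vertex is the case of a singleton.
  Minima and maxima below are only meaningful over nonempty sets; for a nonempty finite graph
  and nonempty sets of vertices this is satisfied.
\<close>

definition set_gdist :: "('a, 'b) pre_digraph \<Rightarrow> 'a set \<Rightarrow> 'a set \<Rightarrow> real" where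
  "set_gdist G S T = Min {gdist G u v | u v. u \<in> S \<and> v \<in> T}"

definition ecc :: "('a, 'b) pre_digraph \<Rightarrow> 'a \<Rightarrow> real" where
  "ecc G v = Max (gdist G v ` verts G)"

definition rad :: "('a, 'b) pre_digraph \<Rightarrow> real" where
  "rad G = Min (ecc G ` verts G)"

definition center :: "('a, 'b) pre_digraph \<Rightarrow> 'a set" where
  "center G = {v \<in> verts G. ecc G v = rad G}"

definition uni_ecc :: "('a, 'b) pre_digraph \<Rightarrow> bool" where
  "uni_ecc G \<longleftrightarrow> (\<forall>v \<in> verts G. set_gdist G (center G) {v} = ecc G v - rad G)"

definition quasi_isometry ::
  "nat \<Rightarrow> nat \<Rightarrow> nat \<Rightarrow> ('a, 'b) pre_digraph \<Rightarrow> ('c, 'd) pre_digraph \<Rightarrow> ('a \<Rightarrow> 'c) \<Rightarrow> bool" where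
  "quasi_isometry A B C G H f \<longleftrightarrow>
     A \<ge> 1 \<and> f ` verts G \<subseteq> verts H \<and>
     (\<forall>x \<in> verts G. \<forall>y \<in> verts G.
        1 / real A * gdist G x y - real B \<le> gdist H (f x) (f y) \<and>
        gdist H (f x) (f y) \<le> real A * gdist G x y + real B) \<and>
     (\<forall>y \<in> verts H. \<exists>x \<in> verts G. gdist H y (f x) \<le> real C)"

definition center_shift ::
  "('a, 'b) pre_digraph \<Rightarrow> ('c, 'd) pre_digraph \<Rightarrow> ('a \<Rightarrow> 'c) \<Rightarrow> real" where
  "center_shift G H f = set_gdist G (center G) {v \<in> verts G. f v \<in> center H}"

end

theory Submission
  imports Defs
begin

text \<open>For any \<open>v\<close> with \<open>\<phi> v\<close> in the center of \<open>H\<close>,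
  the shift is at most the distance from the center of \<open>G\<close> to \<open>v\<close>, and the
  uni-ecc property turns that distance into \<open>ecc G v - rad G\<close>. It remains to bound the
  two terms separately. The lower quasi-isometry inequality at \<open>v\<close> gives
  \<open>ecc G v\<close> \<le> A (rad H + B). The upper one at a central vertex of \<open>G\<close>
  gives \<open>rad H\<close> \<le> A rad G + B, that is, \<open>rad G\<close> \<ge> (rad H - B) / A.
  Subtracting yields the bound.\<close>

lemma connected_imp_verts_nonempty:
  assumes "Digraph_Component.connected G"
  shows "verts G \<noteq> {}"
  using assms by (auto simp: connected_def strongly_connected_def)

lemma gdist_le_ecc:
  assumes "finite (verts G)" and "x \<in> verts G"
  shows "gdist G v x \<le> ecc G v"
  using assms by (simp add: ecc_def)

lemma ecc_leI:
  assumes "finite (verts G)" and "verts G \<noteq> {}"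
    and "\<And>x. x \<in> verts G \<Longrightarrow> gdist G v x \<le> r"
  shows "ecc G v \<le> r"
  using assms by (simp add: ecc_def)

lemma rad_le_ecc:
  assumes "finite (verts G)" and "v \<in> verts G"
  shows "rad G \<le> ecc G v"
  using assms by (simp add: rad_def)

lemma center_nonempty:
  assumes "finite (verts G)" and "verts G \<noteq> {}"
  shows "center G \<noteq> {}"
proof -
  have "rad G \<in> ecc G ` verts G"
    unfolding rad_def using assms by (intro Min_in) auto
  then show ?thesis
    by (auto simp: center_def)
qed

text \<open>A minimum over more pairs can only drop. Since \<open>Min\<close> is meaningful only on
  finite nonempty sets, the smaller set of pairs must be nonempty and the larger one finite.\<close>

lemma set_gdist_antimono:
  assumes "finite S" and "finite T'" and "S \<noteq> {}" and "T \<noteq> {}" and "T \<subseteq> T'"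
  shows "set_gdist G S T' \<le> set_gdist G S T"
  unfolding set_gdist_def
proof (rule Min_antimono)
  show "{gdist G u v |u v. u \<in> S \<and> v \<in> T} \<subseteq> {gdist G u v |u v. u \<in> S \<and> v \<in> T'}"
    and "{gdist G u v |u v. u \<in> S \<and> v \<in> T} \<noteq> {}"
    using assms by auto
  show "finite {gdist G u v |u v. u \<in> S \<and> v \<in> T'}"
    using assms by (intro finite_image_set2) auto
qed

theorem theorem3:
  fixes G :: "('a, 'b) pre_digraph" and H :: "('c, 'd) pre_digraph"
    and \<phi> :: "'a \<Rightarrow> 'c" and A B C :: nat
  assumes "graph G" and "Digraph_Component.connected G"
    and "graph H" and "Digraph_Component.connected H"
    and "uni_ecc G"
    and "quasi_isometry A B C G H \<phi>"
    and "\<phi> ` verts G = verts H"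
  shows "center_shift G H \<phi> \<le>
    (real A - 1 / real A) * rad H + real A * real B + real B / real A"
proof -
  interpret G: graph G by fact
  interpret H: graph H by fact
  have neG: "verts G \<noteq> {}" and neH: "verts H \<noteq> {}"
    using assms(2,4) by (simp_all add: connected_imp_verts_nonempty)
  have A: "real A > 0"
    and lower: "\<And>x y. \<lbrakk>x \<in> verts G; y \<in> verts G\<rbrakk> \<Longrightarrow>
      1 / real A * gdist G x y - real B \<le> gdist H (\<phi> x) (\<phi> y)"
    and upper: "\<And>x y. \<lbrakk>x \<in> verts G; y \<in> verts G\<rbrakk> \<Longrightarrow>
      gdist H (\<phi> x) (\<phi> y) \<le> real A * gdist G x y + real B"
    using assms(6) by (auto simp: quasi_isometry_def)
  obtain c where c: "c \<in> verts G" "c \<in> center G" "ecc G c = rad G"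
    using center_nonempty[OF G.finite_verts neG] by (auto simp: center_def)
  obtain h where h: "h \<in> verts H" "h \<in> center H" "ecc H h = rad H"
    using center_nonempty[OF H.finite_verts neH] by (auto simp: center_def)
  then obtain v where v: "v \<in> verts G" "\<phi> v \<in> center H" "ecc H (\<phi> v) = rad H"
    using assms(7) by (metis imageE)

  \<comment> \<open>The image of a central vertex \<open>c\<close> need not be central in
    \<open>H\<close>, but its eccentricity is at least \<open>rad H\<close>. By surjectivity every
    vertex of \<open>H\<close> is some \<open>\<phi> x\<close>, with \<open>x\<close> within
    \<open>rad G\<close> of \<open>c\<close>, so this eccentricity is also bounded above.\<close>
  have "rad H \<le> ecc H (\<phi> c)"
    using c(1) assms(7) by (intro rad_le_ecc) auto
  also have "\<dots> \<le> real A * rad G + real B"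
  proof (rule ecc_leI[OF H.finite_verts neH])
    fix y assume "y \<in> verts H"
    then obtain x where x: "x \<in> verts G" "y = \<phi> x"
      using assms(7) by auto
    have "gdist G c x \<le> rad G"
      using gdist_le_ecc[OF G.finite_verts x(1)] c(3) by metis
    then have "real A * gdist G c x \<le> real A * rad G"
      using A by simp
    then show "gdist H (\<phi> c) y \<le> real A * rad G + real B"
      using upper[OF c(1) x(1)] x(2) by simp
  qed
  finally have rad_G: "rad H / real A - real B / real A \<le> rad G"
    using A by (simp add: field_simps)

  \<comment> \<open>Here the roles are reversed: \<open>\<phi> v\<close> is central, so all images
    lie within \<open>rad H\<close> of it, and the lower inequality pulls this bound back to
    \<open>G\<close>.\<close>
  have ecc_v: "ecc G v \<le> real A * rad H + real A * real B"
  proof (rule ecc_leI[OF G.finite_verts neG])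
    fix x assume x: "x \<in> verts G"
    then have "gdist H (\<phi> v) (\<phi> x) \<le> rad H"
      using gdist_le_ecc[OF H.finite_verts] assms(7) v(3) by (metis imageI)
    then have "1 / real A * gdist G v x \<le> rad H + real B"
      using lower[OF v(1) x] by simp
    then show "gdist G v x \<le> real A * rad H + real A * real B"
      using A by (simp add: field_simps)
  qed

  \<comment> \<open>Shrinking the fibre over the center of \<open>H\<close> to the single vertex
    \<open>v\<close> makes the uni-ecc property applicable.\<close>
  have "center_shift G H \<phi> \<le> set_gdist G (center G) {v}"
    unfolding center_shift_def using c(2) v(1,2)
    by (intro set_gdist_antimono) (auto simp: center_def)
  also have "\<dots> = ecc G v - rad G"
    using assms(5) v(1) by (simp add: uni_ecc_def)
  also have "\<dots> \<le> (real A - 1 / real A) * rad H + real A * real B + real B / real A"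
    using rad_G ecc_v by (simp add: left_diff_distrib)
  finally show ?thesis .
qed

end
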